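(* Let $k$ be a subfield of $\mathbb C$ closed under complex conjugation, let $G=\mathbb Z_2\wr\mathbb Z$ be the lamplighter group, and let $\mathcal F$ be the monogenic free inverse monoid. Then there exists a $*$-algebra embedding of $k[\mathcal F]$ into $kG$ which sends the canonical generator $s$ of $\mathcal F$ to $e_0t$.
   Context: $G=\mathbb Z_2\wr\mathbb Z=\bigl(\bigoplus_{i\in\mathbb Z}\mathbb Z_2\bigr)\rtimes\mathbb Z$; $t$ denotes the generator corresponding to $\mathbb Z$ and $a_i$ the generator of the $i$-th copy of $\mathbb Z_2$, so that $a_i^2=1$, $a_ia_j=a_ja_i$ and $t^{-1}a_it=a_{i+1}$. In $kG$ put $e_i=\frac{1+a_i}{2}$. The field $k$ carries complex conjugation as involution, and $kG$ the standard involution $(\sum\lambda_g g)^*=\sum\overline{\lambda_g}\,g^{-1}$. An inverse semigroup is a semigroup $S$ such that each $a\in S$ has a unique $a^*\in S$ with $aa^*a=a$ and $a^*aa^*=a^*$. $\mathcal F$ is the free inverse monoid on one generator $s$; $k[\mathcal F]$ is its (unital) monoid algebra with involution $(\sum\lambda_w w)^*=\sum\overline{\lambda_w}\,w^*$. *)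

theory Defs
  imports Complex_Main "HOL-Library.Poly_Mapping" "HOL-Library.Z2"
begin

text \<open>
  The monoid algebra of a monoid \<open>M\<close> over \<open>\<complex>\<close> is the ring \<open>M \<Rightarrow>\<^sub>0 complex\<close> of finitely supported
  functions under convolution. Its ring structure is provided for the class
  \<^class>\<open>monoid_add\<close>, in which addition need not be commutative. Therefore all the
  (noncommutative) groups and monoids below are written additively: \<open>x + y\<close>, \<open>0\<close> and \<open>- x\<close>
  stand for the product \<open>xy\<close>, the identity \<open>1\<close> and the inverse of \<open>x\<close>, and the basis element
  of the algebra belonging to \<open>x\<close> is \<open>Poly_Mapping.single x 1\<close>.
\<close>


section \<open>Algebras over a subfield of the complex numbers\<close>

definition conj_closed_subfield :: "complex set \<Rightarrow> bool" where
  "conj_closed_subfield K \<longleftrightarrow>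
     0 \<in> K \<and> 1 \<in> K \<and>
     (\<forall>x\<in>K. \<forall>y\<in>K. x + y \<in> K \<and> x * y \<in> K) \<and>
     (\<forall>x\<in>K. - x \<in> K \<and> inverse x \<in> K) \<and>
     (\<forall>x\<in>K. cnj x \<in> K)"

definition monoid_algebra :: "complex set \<Rightarrow> ('m \<Rightarrow>\<^sub>0 complex) set" where
  "monoid_algebra K = {f. \<forall>w. Poly_Mapping.lookup f w \<in> K}"

definition scale :: "complex \<Rightarrow> ('m \<Rightarrow>\<^sub>0 complex) \<Rightarrow> ('m \<Rightarrow>\<^sub>0 complex)" where
  "scale c f = Poly_Mapping.map ((*) c) f"

text \<open>The involution \<open>(\<Sum> \<lambda>\<^sub>w w)\<^sup>* = \<Sum> cnj \<lambda>\<^sub>w (j w)\<close> induced by an involution \<open>j\<close> of the monoid.\<close>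

definition alg_star :: "('m \<Rightarrow> 'm) \<Rightarrow> ('m \<Rightarrow>\<^sub>0 complex) \<Rightarrow> ('m \<Rightarrow>\<^sub>0 complex)" where
  "alg_star j f =
     (\<Sum>w\<in>Poly_Mapping.keys f. Poly_Mapping.single (j w) (cnj (Poly_Mapping.lookup f w)))"

text \<open>Only the restriction of \<open>\<Phi>\<close> to \<^term>\<open>monoid_algebra K\<close> matters.\<close>

definition star_algebra_embedding ::
  "complex set \<Rightarrow> ('m::monoid_add \<Rightarrow> 'm) \<Rightarrow> ('n::monoid_add \<Rightarrow> 'n) \<Rightarrow>
     (('m \<Rightarrow>\<^sub>0 complex) \<Rightarrow> ('n \<Rightarrow>\<^sub>0 complex)) \<Rightarrow> bool" where
  "star_algebra_embedding K i j \<Phi> \<longleftrightarrow>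
     (\<forall>x\<in>monoid_algebra K. \<Phi> x \<in> monoid_algebra K) \<and>
     inj_on \<Phi> (monoid_algebra K) \<and>
     \<Phi> 1 = 1 \<and>
     (\<forall>x\<in>monoid_algebra K. \<forall>y\<in>monoid_algebra K.
        \<Phi> (x + y) = \<Phi> x + \<Phi> y \<and> \<Phi> (x * y) = \<Phi> x * \<Phi> y) \<and>
     (\<forall>c\<in>K. \<forall>x\<in>monoid_algebra K. \<Phi> (scale c x) = scale c (\<Phi> x)) \<and>
     (\<forall>x\<in>monoid_algebra K. \<Phi> (alg_star i x) = alg_star j (\<Phi> x))"


section \<open>The lamplighter group\<close>

text \<open>
  \<open>Lamplighter f n\<close> is the element \<open>(\<Prod>\<^sub>i a\<^sub>i\<^bsup>f i\<^esup>) t\<^sup>n\<close> of the semidirect product. As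
  \<open>t\<inverse> a\<^sub>i t = a\<^bsub>i+1\<^esub>\<close>, we have \<open>t\<^sup>n a\<^sub>i t\<^bsup>-n\<^esup> = a\<^bsub>i-n\<^esub>\<close>, which determines the action \<open>shift\<close>.
\<close>

datatype lamplighter = Lamplighter (lamps: "int \<Rightarrow>\<^sub>0 bit") (pos: int)

definition shift :: "int \<Rightarrow> (int \<Rightarrow>\<^sub>0 bit) \<Rightarrow> (int \<Rightarrow>\<^sub>0 bit)" where
  "shift n f = Poly_Mapping.map_key (\<lambda>i. i + n) f"

lemma lookup_shift [simp]: "Poly_Mapping.lookup (shift n f) i = Poly_Mapping.lookup f (i + n)"
  by (simp add: shift_def map_key.rep_eq)

lemma shift_0 [simp]: "shift 0 f = f"
  and shift_zero [simp]: "shift n 0 = 0"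
  and shift_shift [simp]: "shift m (shift n f) = shift (m + n) f"
  and shift_add: "shift n (f + g) = shift n f + shift n g"
  and shift_uminus: "shift n (- f) = - shift n f"
  and shift_single: "shift n (Poly_Mapping.single i b) = Poly_Mapping.single (i - n) b"
  by (auto intro!: poly_mapping_eqI
        simp: lookup_add lookup_uminus lookup_single when_def add.assoc)

instantiation lamplighter :: group_add
begin

definition zero_lamplighter :: lamplighter where
  "0 = Lamplighter 0 0"

definition plus_lamplighter :: "lamplighter \<Rightarrow> lamplighter \<Rightarrow> lamplighter" where
  "x + y = Lamplighter (lamps x + shift (pos x) (lamps y)) (pos x + pos y)"

definition uminus_lamplighter :: "lamplighter \<Rightarrow> lamplighter" where
  "- x = Lamplighter (shift (- pos x) (- lamps x)) (- pos x)"

definition minus_lamplighter :: "lamplighter \<Rightarrow> lamplighter \<Rightarrow> lamplighter" where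
  "x - y = x + - (y :: lamplighter)"

instance
proof
  fix x y z :: lamplighter
  show "x + y + z = x + (y + z)"
    by (simp add: plus_lamplighter_def shift_add add.assoc)
  show "0 + x = x" "x + 0 = x"
    by (simp_all add: plus_lamplighter_def zero_lamplighter_def)
  show "- x + x = 0"
    by (simp add: plus_lamplighter_def zero_lamplighter_def uminus_lamplighter_def
        flip: shift_add)
  show "x + - y = x - y"
    by (simp add: minus_lamplighter_def)
qed

end

definition lamp :: "int \<Rightarrow> lamplighter" where
  "lamp i = Lamplighter (Poly_Mapping.single i 1) 0"

definition lt :: lamplighter where
  "lt = Lamplighter 0 1"

lemma lamp_involutive: "lamp i + lamp i = 0"
  and lamp_commute: "lamp i + lamp j = lamp j + lamp i"
  and lamp_conj: "- lt + lamp i + lt = lamp (i + 1)"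
  by (simp_all add: lamp_def lt_def plus_lamplighter_def zero_lamplighter_def
      uminus_lamplighter_def shift_single add.commute flip: single_add)

text \<open>The idempotent \<open>e\<^sub>i = (1 + a\<^sub>i) / 2\<close>.\<close>

definition lamp_idem :: "int \<Rightarrow> (lamplighter \<Rightarrow>\<^sub>0 complex)" where
  "lamp_idem i = scale (1 / 2) (1 + Poly_Mapping.single (lamp i) 1)"


section \<open>Inverse monoids\<close>

class inverse_monoid = monoid_add +
  assumes ex1_inverse: "\<exists>!b. a + b + a = a \<and> b + a + b = b"
begin

definition inv_star :: "'a \<Rightarrow> 'a" where
  "inv_star a = (THE b. a + b + a = a \<and> b + a + b = b)"

lemma inv_star: "a + inv_star a + a = a" "inv_star a + a + inv_star a = inv_star a"
  using theI'[OF ex1_inverse[of a]] by (auto simp: inv_star_def)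

lemma inv_star_unique: "a + b + a = a \<Longrightarrow> b + a + b = b \<Longrightarrow> inv_star a = b"
  using ex1_inverse[of a] inv_star[of a] by blast

lemma inv_star_inv_star [simp]: "inv_star (inv_star a) = a"
  by (rule inv_star_unique) (simp_all add: inv_star)

lemma inv_star_zero [simp]: "inv_star 0 = 0"
  by (rule inv_star_unique) simp_all

lemma idem_add:
  assumes e: "e + e = e" and f: "f + f = f"
  shows "e + f + (e + f) = e + f"
proof -
  define x where "x = inv_star (e + f)"
  have x1: "e + f + x + (e + f) = e + f" and x2: "x + (e + f) + x = x"
    using inv_star[of "e + f"] by (simp_all add: x_def)
  have e': "e + (e + z) = e + z" and f': "f + (f + z) = f + z" for z
    using e f by (metis add.assoc)+
  have x2': "x + (e + (f + (x + z))) = x + z" for z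
    using x2 by (metis add.assoc)
  have "inv_star (e + f) = f + x + e"
    using x1 x2' by (intro inv_star_unique) (simp_all add: add.assoc e' f' e f)
  then have x: "x = f + x + e" by (simp add: x_def)
  have "x + x = f + x + e + (f + x + e)" using x by simp
  also have "\<dots> = f + x + e" by (simp add: add.assoc x2')
  finally have "x + x = x" using x by simp
  then have "inv_star x = x" by (intro inv_star_unique) simp_all
  then have "x = e + f" by (metis x_def inv_star_inv_star)
  with \<open>x + x = x\<close> show ?thesis by simp
qed

lemma idem_commute:
  assumes e: "e + e = e" and f: "f + f = f"
  shows "e + f = f + e"
proof -
  have ef: "e + (f + (e + f)) = e + f" and fe: "f + (e + (f + e)) = f + e"
    using idem_add[OF e f] idem_add[OF f e] by (simp_all add: add.assoc)
  have e': "e + (e + z) = e + z" and f': "f + (f + z) = f + z" for z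
    using e f by (metis add.assoc)+
  have "inv_star (e + f) = f + e"
    by (rule inv_star_unique) (simp_all add: add.assoc e' f' ef fe)
  moreover have "inv_star (e + f) = e + f"
    by (rule inv_star_unique) (simp_all add: add.assoc e' f' ef)
  ultimately show ?thesis by simp
qed

lemma idem_star: "a + inv_star a + (a + inv_star a) = a + inv_star a"
  by (metis add.assoc inv_star(1))

lemma projections_commute:
  "a + inv_star a + (b + inv_star b) = b + inv_star b + (a + inv_star a)"
  by (rule idem_commute) (rule idem_star)+

lemma inv_star_add: "inv_star (a + b) = inv_star b + inv_star a"
proof (rule inv_star_unique)
  have c: "b + inv_star b + (inv_star a + a) = inv_star a + a + (b + inv_star b)"
    using projections_commute[of b "inv_star a"] by simp
  have "a + b + (inv_star b + inv_star a) + (a + b)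
      = a + (b + inv_star b + (inv_star a + a)) + b" by (simp add: add.assoc)
  also have "\<dots> = a + inv_star a + a + (b + inv_star b + b)" by (simp add: c) (simp add: add.assoc)
  finally show "a + b + (inv_star b + inv_star a) + (a + b) = a + b" by (simp add: inv_star)
  have "inv_star b + inv_star a + (a + b) + (inv_star b + inv_star a)
      = inv_star b + (inv_star a + a + (b + inv_star b)) + inv_star a" by (simp add: add.assoc)
  also have "\<dots> = inv_star b + b + inv_star b + (inv_star a + a + inv_star a)"
    by (simp flip: c) (simp add: add.assoc)
  finally show "inv_star b + inv_star a + (a + b) + (inv_star b + inv_star a)
      = inv_star b + inv_star a" by (simp add: inv_star)
qed

end


section \<open>Free inverse monoids\<close>

text \<open>
  The free inverse monoid on \<open>X\<close> is the quotient of the free monoid on \<open>X \<union> X\<^sup>*\<close> by the Wagner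
  congruence. The letter \<open>(x, True)\<close> stands for \<open>x\<close> and \<open>(x, False)\<close> for \<open>x\<^sup>*\<close>.
  That this is the free inverse monoid is justified by \<open>fim_universal\<close> below.
\<close>

definition wstar :: "('x \<times> bool) list \<Rightarrow> ('x \<times> bool) list" where
  "wstar w = rev (map (apsnd Not) w)"

lemma wstar_simps [simp]:
  "wstar [] = []" "wstar (u @ v) = wstar v @ wstar u" "wstar (wstar w) = w"
  by (simp_all add: wstar_def rev_map o_def apsnd_def map_prod_def case_prod_unfold)

inductive wagner :: "('x \<times> bool) list \<Rightarrow> ('x \<times> bool) list \<Rightarrow> bool" where
  refl: "wagner w w"
| sym: "wagner u v \<Longrightarrow> wagner v u"
| trans: "wagner u v \<Longrightarrow> wagner v w \<Longrightarrow> wagner u w"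
| cong: "wagner u v \<Longrightarrow> wagner (x @ u @ y) (x @ v @ y)"
| regular: "wagner (w @ wstar w @ w) w"
| commute: "wagner (w @ wstar w @ z @ wstar z) (z @ wstar z @ w @ wstar w)"

quotient_type 'x fim = "('x \<times> bool) list" / wagner
  by (rule equivpI) (auto simp: reflp_def symp_def transp_def
      intro: wagner.refl wagner.sym wagner.trans)

lemma wagner_append: "wagner u u' \<Longrightarrow> wagner v v' \<Longrightarrow> wagner (u @ v) (u' @ v')"
  using wagner.cong[of u u' "[]" v] wagner.cong[of v v' u' "[]"]
  by (auto intro: wagner.trans)

lemma wagner_wstar: "wagner u v \<Longrightarrow> wagner (wstar u) (wstar v)"
proof (induction rule: wagner.induct)
  case (regular w)
  then show ?case using wagner.regular[of "wstar w"] by simp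
next
  case (commute w z)
  then show ?case using wagner.commute[of z w] by simp
qed (auto intro: wagner.intros)

instantiation fim :: (type) monoid_add
begin

lift_definition zero_fim :: "'a fim" is "[]" .

lift_definition plus_fim :: "'a fim \<Rightarrow> 'a fim \<Rightarrow> 'a fim" is "(@)"
  by (rule wagner_append)

instance
  by standard (transfer; simp add: wagner.refl)+

end

lift_definition fim_gen :: "'x \<Rightarrow> 'x fim" is "\<lambda>x. [(x, True)]" .

lift_definition fim_star :: "'x fim \<Rightarrow> 'x fim" is wstar
  by (rule wagner_wstar)

lemma fim_star:
  "a + fim_star a + a = a"
  "fim_star (fim_star a) = a"
  "fim_star (a + b) = fim_star b + fim_star a"
  "a + fim_star a + (b + fim_star b) = b + fim_star b + (a + fim_star a)"
  subgoal by transfer (use wagner.regular in auto)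
  subgoal by transfer (simp add: wagner.refl)
  subgoal by transfer (simp add: wagner.refl)
  subgoal by transfer (use wagner.commute in auto)
  done

lemma fim_star': "fim_star a + a + fim_star a = fim_star a"
  using fim_star(1)[of "fim_star a"] by (simp add: fim_star(2))

lemma fim_idem:
  fixes e :: "'x fim"
  assumes e: "e + e = e"
  shows "e + fim_star e = e"
proof -
  have e': "fim_star e + fim_star e = fim_star e"
    using e fim_star(3)[of e e] by simp
  have "e = e + (fim_star e + fim_star e) + e" by (simp add: e' fim_star)
  also have "\<dots> = e + fim_star e + (fim_star e + e)" by (simp add: add.assoc)
  also have "\<dots> = fim_star e + e + (e + fim_star e)"
    using fim_star(4)[of e "fim_star e"] by (simp add: fim_star(2))
  also have "\<dots> = fim_star e + (e + e) + fim_star e" by (simp add: add.assoc)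
  also have "\<dots> = fim_star e" by (simp add: e fim_star')
  finally show ?thesis using e by simp
qed

instance fim :: (type) inverse_monoid
proof
  fix a :: "'a fim"
  show "\<exists>!b. a + b + a = a \<and> b + a + b = b"
  proof (rule ex_ex1I)
    show "\<exists>b. a + b + a = a \<and> b + a + b = b"
      using fim_star(1) fim_star' by blast
  next
    have comm: "e + f = f + e" if "e + e = e" "f + f = f" for e f :: "'a fim"
      using fim_idem[OF that(1)] fim_idem[OF that(2)] fim_star(4)[of e f] by simp
    fix b c
    assume b: "a + b + a = a \<and> b + a + b = b" and c: "a + c + a = a \<and> c + a + c = c"
    have i: "a + b + (a + b) = a + b" "a + c + (a + c) = a + c"
        "b + a + (b + a) = b + a" "c + a + (c + a) = c + a"
      using b c by (metis add.assoc)+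
    have "b = b + (a + c + a) + b" using b c by simp
    also have "\<dots> = b + (a + c + (a + b))" by (simp add: add.assoc)
    also have "\<dots> = b + (a + b + (a + c))" using comm[OF i(1) i(2)] by simp
    also have "\<dots> = (b + a + b) + a + c" by (simp add: add.assoc)
    also have "\<dots> = b + a + c" using b by simp
    finally have 1: "b = b + a + c" .
    have "c = c + (a + b + a) + c" using b c by simp
    also have "\<dots> = (c + a + (b + a)) + c" by (simp add: add.assoc)
    also have "\<dots> = (b + a + (c + a)) + c" using comm[OF i(4) i(3)] by simp
    also have "\<dots> = b + a + (c + a + c)" by (simp add: add.assoc)
    also have "\<dots> = b + a + c" using c by simp
    finally show "b = c" using 1 by simp
  qed
qed

lemma inv_star_fim: "inv_star = (fim_star :: 'x fim \<Rightarrow> 'x fim)"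
  by (rule ext, rule inv_star_unique) (rule fim_star(1) fim_star')+

fun eval_word :: "('x \<Rightarrow> 'm::inverse_monoid) \<Rightarrow> ('x \<times> bool) list \<Rightarrow> 'm" where
  "eval_word h [] = 0"
| "eval_word h ((x, b) # w) = (if b then h x else inv_star (h x)) + eval_word h w"

lemma eval_word_append: "eval_word h (u @ v) = eval_word h u + eval_word h v"
  by (induction h u rule: eval_word.induct) (simp_all add: add.assoc)

lemma eval_word_wstar: "eval_word h (wstar w) = inv_star (eval_word h w)"
proof (induction h w rule: eval_word.induct)
  case (2 h x b w)
  have "wstar ((x, b) # w) = wstar w @ [(x, \<not> b)]" by (simp add: wstar_def)
  with 2 show ?case by (simp add: eval_word_append inv_star_add)
qed simp

lemma eval_word_wagner: "wagner u v \<Longrightarrow> eval_word h u = eval_word h v"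
proof (induction rule: wagner.induct)
  case (regular w)
  then show ?case using inv_star(1)[of "eval_word h w"]
    by (simp add: eval_word_append eval_word_wstar add.assoc)
next
  case (commute w z)
  then show ?case using projections_commute[of "eval_word h w" "eval_word h z"]
    by (simp add: eval_word_append eval_word_wstar add.assoc)
qed (simp_all add: eval_word_append)

lift_definition fim_lift :: "('x \<Rightarrow> 'm::inverse_monoid) \<Rightarrow> 'x fim \<Rightarrow> 'm" is eval_word
  by (rule eval_word_wagner)

lemma fim_universal:
  fixes h :: "'x \<Rightarrow> 'm::inverse_monoid"
  shows "\<exists>!\<phi>. \<phi> 0 = 0 \<and> (\<forall>a b. \<phi> (a + b) = \<phi> a + \<phi> b) \<and> (\<forall>x. \<phi> (fim_gen x) = h x)"
proof (rule ex_ex1I)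
  have "fim_lift h 0 = 0" "\<And>a b. fim_lift h (a + b) = fim_lift h a + fim_lift h b"
    "\<And>x. fim_lift h (fim_gen x) = h x"
    by (transfer; simp add: eval_word_append)+
  then show "\<exists>\<phi>. \<phi> 0 = 0 \<and> (\<forall>a b. \<phi> (a + b) = \<phi> a + \<phi> b) \<and> (\<forall>x. \<phi> (fim_gen x) = h x)"
    by blast
next
  have *: "\<phi> (abs_fim w) = eval_word h w"
    if \<phi>: "\<phi> 0 = 0 \<and> (\<forall>a b. \<phi> (a + b) = \<phi> a + \<phi> b) \<and> (\<forall>x. \<phi> (fim_gen x) = h x)" for \<phi> w
  proof (induction w)
    case Nil
    then show ?case using \<phi> by (simp add: zero_fim_def)
  next
    case (Cons l w)
    obtain x b where l: "l = (x, b)" by (cases l)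
    have s: "\<phi> (inv_star a) = inv_star (\<phi> a)" for a
      using inv_star[of a] \<phi> by (metis inv_star_unique)
    have "abs_fim [(x, False)] = fim_star (fim_gen x)"
      by (simp add: fim_gen_def fim_star.abs_eq wstar_def)
    then have "\<phi> (abs_fim [l]) = (if b then h x else inv_star (h x))"
      using \<phi> s[of "fim_gen x"] by (auto simp: l inv_star_fim fim_gen_def)
    moreover have "abs_fim (l # w) = abs_fim [l] + abs_fim w"
      by (simp add: plus_fim.abs_eq)
    ultimately show ?case using \<phi> Cons by (simp add: l)
  qed
  fix \<phi> \<psi> :: "'x fim \<Rightarrow> 'm"
  assume "\<phi> 0 = 0 \<and> (\<forall>a b. \<phi> (a + b) = \<phi> a + \<phi> b) \<and> (\<forall>x. \<phi> (fim_gen x) = h x)"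
    and "\<psi> 0 = 0 \<and> (\<forall>a b. \<psi> (a + b) = \<psi> a + \<psi> b) \<and> (\<forall>x. \<psi> (fim_gen x) = h x)"
  note * [OF this(1)] * [OF this(2)]
  then have "\<phi> a = \<psi> a" for a by (induction a rule: fim.abs_induct) simp
  then show "\<phi> = \<psi>" by blast
qed

type_synonym monogenic_fim = "unit fim"

abbreviation fim_s :: monogenic_fim where
  "fim_s \<equiv> fim_gen ()"

end

theory Submission
  imports Defs
begin

text \<open>
  Pushing all powers of \<open>t\<close> to the right, a word in \<open>e\<^sub>0 t\<close> and its adjoint becomes
  \<open>(\<Prod>i\<in>A. e\<^sub>i) t\<^sup>n\<close>, where \<open>A\<close> records the edges and \<open>n\<close> the endpoint of the walk on \<open>\<int>\<close>
  described by the word. This gives a homomorphism because the pair \<open>(A, n)\<close> respects the Wagner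
  congruence, and \<open>(A, n)\<close> determines the element of \<open>\<F>\<close> by its normal form. The elements
  \<open>(\<Prod>i\<in>A. e\<^sub>i) t\<^sup>n\<close> are linearly independent: in a vanishing combination take a pair
  with \<open>A\<close> of maximal size; then no other pair contributes to the coefficient of
  \<open>(\<Prod>i\<in>A. a\<^sub>i) t\<^sup>n\<close>.
\<close>

section \<open>Linear extension of monoid homomorphisms\<close>

lemma lookup_scale [simp]: "Poly_Mapping.lookup (scale c f) w = c * Poly_Mapping.lookup f w"
  by (simp add: scale_def map.rep_eq when_def)

lemma scale_single [simp]: "scale c (Poly_Mapping.single w d) = Poly_Mapping.single w (c * d)"
  by (rule poly_mapping_eqI) (simp add: lookup_single when_def)

lemma scale_1 [simp]: "scale 1 f = f"
  by (rule poly_mapping_eqI) simp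

lemma scale_zero [simp]: "scale c 0 = 0"
  by (rule poly_mapping_eqI) simp

lemma scale_0 [simp]: "scale 0 f = 0"
  by (rule poly_mapping_eqI) simp

lemma scale_add: "scale c (f + g) = scale c f + scale c g"
  by (rule poly_mapping_eqI) (simp add: lookup_add algebra_simps)

lemma scale_add_left: "scale (c + d) f = scale c f + scale d f"
  by (rule poly_mapping_eqI) (simp add: lookup_add algebra_simps)

lemma scale_scale: "scale c (scale d f) = scale (c * d) f"
  by (rule poly_mapping_eqI) simp

lemma scale_sum: "scale c (sum f A) = (\<Sum>i\<in>A. scale c (f i))"
  by (induction A rule: infinite_finite_induct) (simp_all add: scale_add)

lemma sum_single_lookup:
  fixes f :: "'m \<Rightarrow>\<^sub>0 'b::comm_monoid_add"
  shows "(\<Sum>w\<in>Poly_Mapping.keys f. Poly_Mapping.single w (Poly_Mapping.lookup f w)) = f"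
proof (rule poly_mapping_eqI)
  fix k
  show "Poly_Mapping.lookup (\<Sum>w\<in>Poly_Mapping.keys f.
      Poly_Mapping.single w (Poly_Mapping.lookup f w)) k = Poly_Mapping.lookup f k"
    by (simp add: lookup_sum lookup_single when_def in_keys_iff)
qed

text \<open>Every \<open>f\<close> is a finite sum of its terms, and 0 is the case
  \<open>c = 0\<close> of \<open>single\<close>. Identities additive in \<open>f\<close> thus reduce
  to basis elements.\<close>

lemma single_add_induct [case_names single add]:
  fixes f :: "'m \<Rightarrow>\<^sub>0 'b::comm_monoid_add"
  assumes single: "\<And>w c. P (Poly_Mapping.single w c)"
    and add: "\<And>f g. P f \<Longrightarrow> P g \<Longrightarrow> P (f + g)"
  shows "P f"
proof -
  have "P 0" using single[of undefined 0] by simp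
  then have "P (\<Sum>w\<in>A. Poly_Mapping.single w (Poly_Mapping.lookup f w))" for A
    by (induction A rule: infinite_finite_induct) (auto intro: single add)
  from this[of "Poly_Mapping.keys f"] show ?thesis by (simp add: sum_single_lookup)
qed

lemma scale_mult_left: "scale c f * g = scale c (f * g)"
  by (simp add: scale_def mult_map_scale_conv_mult mult.assoc)

lemma scale_mult_right: "f * scale c g = scale c (f * g)"
proof (induction f rule: single_add_induct)
  case (single w d)
  show ?case
    by (induction g rule: single_add_induct)
      (simp_all add: mult_single scale_add distrib_left mult.left_commute)
qed (simp add: scale_add distrib_right)

lemma sum_keys_superset:
  assumes "finite A" "Poly_Mapping.keys f \<subseteq> A" "\<And>w. F w 0 = 0"
  shows "(\<Sum>w\<in>Poly_Mapping.keys f. F w (Poly_Mapping.lookup f w))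
    = (\<Sum>w\<in>A. F w (Poly_Mapping.lookup f w))"
  by (rule sum.mono_neutral_left) (use assms in \<open>auto simp: in_keys_iff\<close>)

text \<open>Cancellation may shrink the support of \<open>f + g\<close>, so all three sums are taken
  over the union of the supports; the extra terms vanish because \<open>F w 0 = 0\<close>.\<close>

lemma sum_keys_add:
  assumes "\<And>w. F w 0 = 0" "\<And>w c d. F w (c + d) = F w c + F w d"
  shows "(\<Sum>w\<in>Poly_Mapping.keys (f + g). F w (Poly_Mapping.lookup (f + g) w))
    = (\<Sum>w\<in>Poly_Mapping.keys f. F w (Poly_Mapping.lookup f w))
      + (\<Sum>w\<in>Poly_Mapping.keys g. F w (Poly_Mapping.lookup g w))"
  by (subst (1 2 3) sum_keys_superset[where A = "Poly_Mapping.keys f \<union> Poly_Mapping.keys g"])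
    (use keys_add[of f g] in \<open>auto simp: assms lookup_add sum.distrib\<close>)

lemma alg_star_add: "alg_star j (f + g) = alg_star j f + alg_star j g"
  unfolding alg_star_def by (rule sum_keys_add) (simp_all add: single_add)

lemma alg_star_single [simp]:
  "alg_star j (Poly_Mapping.single w c) = Poly_Mapping.single (j w) (cnj c)"
  by (cases "c = 0") (simp_all add: alg_star_def)

lemma alg_star_zero [simp]: "alg_star j 0 = 0"
  by (simp add: alg_star_def)

lemma alg_star_sum: "alg_star j (sum f A) = (\<Sum>i\<in>A. alg_star j (f i))"
  by (induction A rule: infinite_finite_induct) (simp_all add: alg_star_add)

lemma alg_star_scale: "alg_star j (scale c f) = scale (cnj c) (alg_star j f)"
  by (induction f rule: single_add_induct) (simp_all add: scale_add alg_star_add)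

definition lin_ext :: "('m \<Rightarrow> ('n \<Rightarrow>\<^sub>0 complex)) \<Rightarrow> ('m \<Rightarrow>\<^sub>0 complex) \<Rightarrow> ('n \<Rightarrow>\<^sub>0 complex)" where
  "lin_ext \<phi> f = (\<Sum>w\<in>Poly_Mapping.keys f. scale (Poly_Mapping.lookup f w) (\<phi> w))"

lemma lin_ext_single [simp]: "lin_ext \<phi> (Poly_Mapping.single w c) = scale c (\<phi> w)"
  by (cases "c = 0") (simp_all add: lin_ext_def)

lemma lin_ext_add: "lin_ext \<phi> (f + g) = lin_ext \<phi> f + lin_ext \<phi> g"
  unfolding lin_ext_def by (rule sum_keys_add) (simp_all add: scale_add_left)

lemma lin_ext_scale: "lin_ext \<phi> (scale c f) = scale c (lin_ext \<phi> f)"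
  by (induction f rule: single_add_induct) (simp_all add: scale_add lin_ext_add scale_scale)

lemma lin_ext_mult:
  assumes "\<And>a b. \<phi> (a + b) = \<phi> a * \<phi> b"
  shows "lin_ext \<phi> (f * g) = lin_ext \<phi> f * lin_ext \<phi> g"
proof (induction f rule: single_add_induct)
  case (single w c)
  show ?case
    by (induction g rule: single_add_induct)
      (simp_all add: mult_single assms distrib_left lin_ext_add scale_mult_left
        scale_mult_right scale_scale mult.commute)
qed (simp add: distrib_right lin_ext_add)

lemma lin_ext_alg_star:
  assumes "\<And>a. \<phi> (i a) = alg_star j (\<phi> a)"
  shows "lin_ext \<phi> (alg_star i f) = alg_star j (lin_ext \<phi> f)"
  by (induction f rule: single_add_induct)
    (simp_all add: assms alg_star_add lin_ext_add alg_star_scale)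

lemma lookup_lin_ext:
  "Poly_Mapping.lookup (lin_ext \<phi> f) x
    = (\<Sum>w\<in>Poly_Mapping.keys f. Poly_Mapping.lookup f w * Poly_Mapping.lookup (\<phi> w) x)"
  by (simp add: lin_ext_def lookup_sum)

lemma subfield_sum_closed:
  assumes "conj_closed_subfield K" "\<And>i. i \<in> A \<Longrightarrow> f i \<in> K"
  shows "sum f A \<in> K"
  using assms(2)
  by (induction A rule: infinite_finite_induct)
    (use assms(1) in \<open>auto simp: conj_closed_subfield_def\<close>)

lemma star_algebra_embedding_lin_ext:
  assumes K: "conj_closed_subfield K"
    and "\<phi> 0 = 1" "\<And>a b. \<phi> (a + b) = \<phi> a * \<phi> b" "\<And>a. \<phi> (i a) = alg_star j (\<phi> a)"
    and \<phi>K: "\<And>a. \<phi> a \<in> monoid_algebra K"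
    and indep: "\<And>f. lin_ext \<phi> f = 0 \<Longrightarrow> f = 0"
  shows "star_algebra_embedding K i j (lin_ext \<phi>)"
proof -
  have "lin_ext \<phi> f \<in> monoid_algebra K" if "f \<in> monoid_algebra K" for f
  proof -
    have "Poly_Mapping.lookup (lin_ext \<phi> f) x \<in> K" for x
      unfolding lookup_lin_ext
      using that \<phi>K K
      by (intro subfield_sum_closed) (auto simp: monoid_algebra_def conj_closed_subfield_def)
    then show ?thesis by (simp add: monoid_algebra_def)
  qed
  moreover have "f = g" if "lin_ext \<phi> f = lin_ext \<phi> g" for f g
  proof -
    \<comment> \<open>The difference is written with \<open>scale (- 1)\<close> so that additivity
      and homogeneity of \<open>lin_ext\<close> apply directly.\<close>
    have "lin_ext \<phi> (f + scale (- 1) g) = lin_ext \<phi> f + scale (- 1) (lin_ext \<phi> f)"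
      by (simp add: lin_ext_add lin_ext_scale that)
    also have "\<dots> = 0" by (rule poly_mapping_eqI) (simp add: lookup_add)
    finally have "f + scale (- 1) g = 0" by (rule indep)
    then have "Poly_Mapping.lookup (f + scale (- 1) g) x = 0" for x by simp
    then show ?thesis by (intro poly_mapping_eqI) (simp add: lookup_add)
  qed
  moreover have "lin_ext \<phi> 1 = 1"
    using lin_ext_single[of \<phi> 0 1] assms(2) by simp
  ultimately show ?thesis
    unfolding star_algebra_embedding_def
    by (auto intro: inj_onI simp: lin_ext_add lin_ext_scale lin_ext_mult assms lin_ext_alg_star)
qed


section \<open>Normal forms in the monogenic free inverse monoid\<close>

primrec npow :: "nat \<Rightarrow> 'a::monoid_add \<Rightarrow> 'a" where
  "npow 0 x = 0"
| "npow (Suc n) x = x + npow n x"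

lemma npow_add: "npow (m + n) x = npow m x + npow n x"
  by (induction m) (simp_all add: add.assoc)

lemma npow_Suc2: "npow (Suc n) x = npow n x + x"
  using npow_add[of n 1 x] by simp

section \<open>Commuting projections\<close>

definition proj :: "'a::inverse_monoid \<Rightarrow> 'a" where
  "proj a = a + inv_star a"

lemma proj_commute: "proj a + proj b = proj b + proj a"
  unfolding proj_def by (rule projections_commute)

lemma proj_left_commute: "proj a + (proj b + c) = proj b + (proj a + c)"
  by (metis add.assoc proj_commute)

text \<open>The hypothesis says that \<open>proj a\<close> lies below \<open>proj b\<close> in the
  semilattice of idempotents. The trailing \<open>c\<close> suits right-nested products.\<close>

lemma proj_absorb_proj:
  assumes "proj a + proj b = proj a"
  shows "proj a + (proj b + c) = proj a + c" "proj b + (proj a + c) = proj a + c"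
proof -
  show *: "proj a + (proj b + c) = proj a + c" by (simp add: assms flip: add.assoc)
  show "proj b + (proj a + c) = proj a + c" by (subst proj_left_commute) (rule *)
qed

lemma proj_absorb: "proj a + a = a"
  by (simp add: proj_def inv_star)

lemma proj_add: "proj (a + b) + proj a = proj (a + b)"
proof -
  have "proj a + proj (a + b) = proj a + a + (b + inv_star (a + b))"
    by (simp add: proj_def add.assoc)
  also have "\<dots> = proj (a + b)" by (simp add: proj_absorb) (simp add: proj_def add.assoc)
  finally show ?thesis by (simp add: proj_commute)
qed

lemma npow_add_inv_star:
  "npow (Suc k) x + inv_star x = proj (npow (Suc k) x) + npow k x"
  for x :: "'a::inverse_monoid"
proof -
  define y where "y = npow k x"
  have "npow (Suc k) x + inv_star x = y + proj x"
    unfolding npow_Suc2 y_def by (simp add: proj_def add.assoc)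
  also have "\<dots> = (y + inv_star y + y) + proj x" by (simp add: inv_star)
  also have "\<dots> = y + (proj (inv_star y) + proj x)"
    by (simp add: proj_def add.assoc)
  also have "\<dots> = y + (proj x + proj (inv_star y))" by (simp add: proj_commute)
  also have "\<dots> = proj (y + x) + y" by (simp add: proj_def add.assoc inv_star_add)
  finally show ?thesis unfolding npow_Suc2 y_def .
qed

section \<open>Integer powers and Munn elements\<close>

definition zpow :: "int \<Rightarrow> 'a::inverse_monoid \<Rightarrow> 'a" where
  "zpow n x = (if n \<ge> 0 then npow (nat n) x else npow (nat (- n)) (inv_star x))"

lemma zpow_inv_star: "zpow n (inv_star x) = zpow (- n) x"
  by (auto simp: zpow_def)

text \<open>For \<open>m \<ge> 0\<close> the power just grows and absorbs its own projection. For
  \<open>m < 0\<close> the factor \<open>x\<close> cancels a letter \<open>inv_star x\<close>, as in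
  \<open>npow_add_inv_star\<close>.\<close>

lemma zpow_add_gen: "zpow m x + x = proj (zpow m x) + zpow (m + 1) x"
proof (cases "m \<ge> 0")
  case True
  then have "zpow (m + 1) x = zpow m x + x"
    by (simp add: zpow_def nat_add_distrib npow_Suc2 del: npow.simps(2))
  then show ?thesis by (simp add: proj_absorb flip: add.assoc)
next
  case False
  define k where "k = nat (- m - 1)"
  have m: "m = - int (Suc k)" using False by (simp add: k_def)
  have "nat (int k + 1) = Suc k" by simp
  then have "zpow m x = npow (Suc k) (inv_star x)" "zpow (m + 1) x = npow k (inv_star x)"
    by (auto simp: m zpow_def simp del: npow.simps(2))
  then show ?thesis using npow_add_inv_star[of k "inv_star x"] by simp
qed

lemma zpow_add_inv_star: "zpow m x + inv_star x = proj (zpow m x) + zpow (m - 1) x"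
  using zpow_add_gen[of "- m" "inv_star x"] by (simp add: zpow_inv_star)

text \<open>The power with exponent \<open>n\<close> is a prefix of the one with exponent
  \<open>q\<close>: a walk from 0 to \<open>q\<close> passes through \<open>n\<close>.\<close>

lemma proj_zpow_absorb:
  assumes "0 \<le> n" "n \<le> q"
  shows "proj (zpow q x) + proj (zpow n x) = proj (zpow q x)"
proof -
  have "zpow q x = zpow n x + npow (nat (q - n)) x"
    using assms by (simp add: zpow_def nat_diff_distrib flip: npow_add)
  then show ?thesis by (simp add: proj_add)
qed

lemma proj_zpow_absorb_neg:
  assumes "n \<le> 0" "p \<le> n"
  shows "proj (zpow p x) + proj (zpow n x) = proj (zpow p x)"
  using proj_zpow_absorb[of "- n" "- p" "inv_star x"] assms by (simp add: zpow_inv_star)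

text \<open>
  In Munn's description, this element is the walk on the Cayley graph \<open>\<int>\<close> from \<open>0\<close> to \<open>n\<close>
  that visits exactly the vertices in \<open>[- p, q]\<close>.
\<close>

definition munn :: "'a::inverse_monoid \<Rightarrow> int \<Rightarrow> int \<Rightarrow> int \<Rightarrow> 'a" where
  "munn x p q n = proj (zpow (- p) x) + (proj (zpow q x) + zpow n x)"

text \<open>The vertex \<open>n\<close> has been visited already: it lies between 0 and
  \<open>q\<close> or between \<open>- p\<close> and 0, so one of the two projections absorbs its
  own.\<close>

lemma munn_absorb:
  assumes "- p \<le> n" "n \<le> q" "0 \<le> p" "0 \<le> q"
  shows "proj (zpow (- p) x) + (proj (zpow q x) + (proj (zpow n x) + y))
    = proj (zpow (- p) x) + (proj (zpow q x) + y)"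
proof (cases "n \<ge> 0")
  case True
  then show ?thesis using assms by (simp add: proj_absorb_proj(1)[OF proj_zpow_absorb])
next
  case False
  then have "proj (zpow (- p) x) + (proj (zpow n x) + (proj (zpow q x) + y))
      = proj (zpow (- p) x) + (proj (zpow q x) + y)"
    using assms by (intro proj_absorb_proj(1) proj_zpow_absorb_neg) auto
  then show ?thesis by (simp add: proj_left_commute[of "zpow q x"])
qed

text \<open>The projection at \<open>n\<close> produced by \<open>y\<close> is absorbed. What
  remains is to widen the interval if the new endpoint \<open>n + d\<close> lies outside it.\<close>

lemma munn_add:
  assumes pq: "- p \<le> n" "n \<le> q" "0 \<le> p" "0 \<le> q"
    and y: "zpow n x + y = proj (zpow n x) + zpow (n + d) x"
  shows "munn x p q n + y = munn x (max p (- (n + d))) (max q (n + d)) (n + d)"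
proof -
  have y': "munn x p q n + y = munn x p q (n + d)"
    by (simp add: munn_def add.assoc y munn_absorb[OF pq])
  consider "- p \<le> n + d" "n + d \<le> q" | "n + d > q" | "n + d < - p" by linarith
  then show ?thesis
  proof cases
    case 1
    then have "max p (- (n + d)) = p" "max q (n + d) = q" by auto
    then show ?thesis by (simp add: y')
  next
    case 2
    \<comment> \<open>The last factor supplies its own projection, which lies below that of the old
      right end \<open>q\<close> and replaces it. Case 3 does the same at the left end, after
      commuting past the projection at \<open>q\<close>.\<close>
    have "munn x p q (n + d)
        = proj (zpow (- p) x) + (proj (zpow q x) + (proj (zpow (n + d) x) + zpow (n + d) x))"
      by (simp add: munn_def proj_absorb)
    also have "\<dots> = munn x p (n + d) (n + d)"
      using 2 pq by (simp add: munn_def proj_absorb_proj(2)[OF proj_zpow_absorb])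
    finally have "munn x p q (n + d) = munn x p (n + d) (n + d)" .
    moreover have "max p (- (n + d)) = p" "max q (n + d) = n + d" using 2 pq by auto
    ultimately show ?thesis by (simp add: y')
  next
    case 3
    let ?A = "proj (zpow (- p) x)" and ?B = "proj (zpow q x)" and ?z = "zpow (n + d) x"
    have "munn x p q (n + d) = ?A + (?B + (proj ?z + ?z))"
      by (simp add: munn_def proj_absorb)
    also have "\<dots> = ?B + (?A + (proj ?z + ?z))" by (rule proj_left_commute)
    also have "?A + (proj ?z + ?z) = proj ?z + ?z"
      using 3 pq by (intro proj_absorb_proj(2) proj_zpow_absorb_neg) auto
    also have "?B + (proj ?z + ?z) = proj ?z + (?B + ?z)" by (rule proj_left_commute)
    also have "\<dots> = munn x (- (n + d)) q (n + d)" by (simp only: munn_def minus_minus)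
    finally have "munn x p q (n + d) = munn x (- (n + d)) q (n + d)" .
    moreover have "max p (- (n + d)) = - (n + d)" "max q (n + d) = q" using 3 pq by auto
    ultimately show ?thesis by (simp add: y')
  qed
qed

lemma abs_fim_letter:
  "abs_fim [(x, True)] = fim_gen x" "abs_fim [(x, False)] = inv_star (fim_gen x)"
  by (simp_all add: inv_star_fim fim_gen_def fim_star.abs_eq wstar_def)

text \<open>Letters are appended on the right, where \<open>munn\<close> carries its power; hence
  \<open>rev_induct\<close>. Each letter is one step \<open>d\<close> of the walk.\<close>

lemma monogenic_fim_normal_form:
  fixes a :: monogenic_fim
  obtains p q n where "- p \<le> n" "n \<le> q" "0 \<le> p" "0 \<le> q" "a = munn fim_s p q n"
proof -
  have "\<exists>p q n. - p \<le> n \<and> n \<le> q \<and> 0 \<le> p \<and> 0 \<le> q \<and> abs_fim w = munn fim_s p q n"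
    for w :: "(unit \<times> bool) list"
  proof (induction w rule: rev_induct)
    case Nil
    have "abs_fim [] = munn fim_s 0 0 0"
      by (simp add: munn_def zpow_def proj_def flip: zero_fim_def)
    then show ?case by force
  next
    case (snoc l w)
    then obtain p q n where pq: "- p \<le> n" "n \<le> q" "0 \<le> p" "0 \<le> q"
      and w: "abs_fim w = munn fim_s p q n" by blast
    obtain b where l: "l = ((), b)" by (cases l) auto
    define d :: int where "d = (if b then 1 else - 1)"
    have "zpow n fim_s + abs_fim [l] = proj (zpow n fim_s) + zpow (n + d) fim_s"
      using zpow_add_gen[of n fim_s] zpow_add_inv_star[of n fim_s]
      by (simp add: l d_def abs_fim_letter)
    then have "munn fim_s p q n + abs_fim [l]
        = munn fim_s (max p (- (n + d))) (max q (n + d)) (n + d)"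
      by (intro munn_add pq)
    then have "abs_fim (w @ [l]) = munn fim_s (max p (- (n + d))) (max q (n + d)) (n + d)"
      by (simp add: w flip: plus_fim.abs_eq)
    moreover have "- max p (- (n + d)) \<le> n + d" "n + d \<le> max q (n + d)"
      "0 \<le> max p (- (n + d))" "0 \<le> max q (n + d)" using pq by auto
    ultimately show ?case by blast
  qed
  then have "\<exists>p q n. - p \<le> n \<and> n \<le> q \<and> 0 \<le> p \<and> 0 \<le> q \<and> a = munn fim_s p q n"
    by (induction a rule: fim.abs_induct)
  then show ?thesis using that by blast
qed

section \<open>Edges and endpoint as invariants\<close>

text \<open>
  A word describes a walk on \<open>\<int>\<close> starting at \<open>0\<close>. The edge between \<open>m\<close> and \<open>m + 1\<close> is
  labelled by \<open>- m\<close>, because moving \<open>t\<^sup>m\<close> to the right of \<open>e\<^sub>0\<close> turns it into \<open>e\<^bsub>-m\<^esub>\<close>.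
\<close>

fun word_pos :: "('x \<times> bool) list \<Rightarrow> int" where
  "word_pos [] = 0"
| "word_pos ((x, b) # w) = (if b then 1 else - 1) + word_pos w"

fun word_edges :: "('x \<times> bool) list \<Rightarrow> int set" where
  "word_edges [] = {}"
| "word_edges ((x, b) # w) =
     insert (if b then 0 else 1) ((\<lambda>i. i - (if b then 1 else - 1)) ` word_edges w)"

lemma word_pos_append: "word_pos (u @ v) = word_pos u + word_pos v"
  by (induction u rule: word_pos.induct) auto

lemma word_edges_append:
  "word_edges (u @ v) = word_edges u \<union> (\<lambda>i. i - word_pos u) ` word_edges v"
  by (induction u rule: word_pos.induct) (simp_all add: image_image image_Un diff_diff_eq add.commute)

lemma wstar_Cons: "wstar ((x, b) # w) = wstar w @ [(x, \<not> b)]"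
  by (simp add: wstar_def)

lemma word_pos_wstar: "word_pos (wstar w) = - word_pos w"
  by (induction w rule: word_pos.induct) (auto simp: wstar_Cons word_pos_append)

text \<open>The walk is run backwards and translated by \<open>- word_pos w\<close> to start at 0.
  Labels are negated vertices, so they increase by \<open>word_pos w\<close>.\<close>

lemma word_edges_wstar: "word_edges (wstar w) = (\<lambda>i. i + word_pos w) ` word_edges w"
  by (induction w rule: word_pos.induct)
    (simp_all add: wstar_Cons word_pos_wstar word_edges_append image_image add.commute)

lemma word_pos_wagner: "wagner u v \<Longrightarrow> word_pos u = word_pos v"
  by (induction rule: wagner.induct) (simp_all add: word_pos_append word_pos_wstar)

text \<open>The word \<open>w @ wstar w\<close> is a closed walk with the same edges as
  \<open>w\<close>. Hence \<open>regular\<close> adds no edge, and \<open>commute\<close> becomes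
  commutativity of union. In \<open>cong\<close> the edges of \<open>y\<close> stay put because
  endpoints agree.\<close>

lemma word_edges_wagner: "wagner u v \<Longrightarrow> word_edges u = word_edges v"
proof (induction rule: wagner.induct)
  case (cong u v x y)
  then show ?case by (simp add: word_edges_append word_pos_wagner)
qed (simp_all add: word_edges_append word_pos_append word_pos_wstar word_edges_wstar image_image
    image_Un Un_ac)

lift_definition fim_pos :: "'x fim \<Rightarrow> int" is word_pos
  by (rule word_pos_wagner)

lift_definition fim_edges :: "'x fim \<Rightarrow> int set" is word_edges
  by (rule word_edges_wagner)

lemma fim_pos_simps [simp]:
  "fim_pos 0 = 0" "fim_pos (a + b) = fim_pos a + fim_pos b"
  "fim_pos (inv_star a) = - fim_pos a" "fim_pos (fim_gen x) = 1"
  unfolding inv_star_fim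
  by (transfer; simp add: word_pos_append word_pos_wstar)+

lemma fim_edges_simps [simp]:
  "fim_edges 0 = {}" "fim_edges (fim_gen x) = {0}"
  "fim_edges (a + b) = fim_edges a \<union> (\<lambda>i. i - fim_pos a) ` fim_edges b"
  "fim_edges (inv_star a) = (\<lambda>i. i + fim_pos a) ` fim_edges a"
  unfolding inv_star_fim
  by (transfer; simp add: word_edges_append word_edges_wstar)+

lemma finite_fim_edges [simp]: "finite (fim_edges a)"
proof transfer
  show "finite (word_edges w)" for w :: "('x \<times> bool) list"
    by (induction w rule: word_pos.induct) auto
qed

lemma fim_pos_proj [simp]: "fim_pos (proj a) = 0"
  by (simp add: proj_def)

lemma fim_edges_proj [simp]: "fim_edges (proj a) = fim_edges a"
  by (simp add: proj_def image_image)

lemma fim_pos_npow: "fim_pos (npow n a) = int n * fim_pos a"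
  by (induction n) (simp_all add: algebra_simps)

lemma fim_pos_zpow [simp]: "fim_pos (zpow n (fim_gen x)) = n"
  by (simp add: zpow_def fim_pos_npow)

lemma image_diff_int: "(\<lambda>i. i - c) ` {a..b} = {a - c..b - (c::int)}"
  using image_add_atLeastAtMost'[of "- c" a b] by simp

lemma fim_edges_npow_gen: "fim_edges (npow n (fim_gen x)) = {1 - int n..0}"
  by (induction n) (auto simp: image_diff_int)

lemma fim_edges_npow_inv_gen: "fim_edges (npow n (inv_star (fim_gen x))) = {1..int n}"
  by (induction n) auto

text \<open>At least one of the two intervals is empty, according to the sign of
  \<open>n\<close>.\<close>

lemma fim_edges_zpow: "fim_edges (zpow n (fim_gen x)) = {1 - n..0} \<union> {1..- n}"
  by (simp add: zpow_def fim_edges_npow_gen fim_edges_npow_inv_gen)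

lemma fim_pos_munn: "fim_pos (munn (fim_gen x) p q n) = n"
  by (simp add: munn_def)

lemma fim_edges_munn:
  assumes "- p \<le> n" "n \<le> q" "0 \<le> p" "0 \<le> q"
  shows "fim_edges (munn (fim_gen x) p q n) = {1 - q..p}"
  using assms by (auto simp: munn_def fim_edges_zpow)

lemma monogenic_fim_eqI:
  fixes a b :: monogenic_fim
  assumes "fim_edges a = fim_edges b" "fim_pos a = fim_pos b"
  shows "a = b"
proof -
  obtain p q n where a: "- p \<le> n" "n \<le> q" "0 \<le> p" "0 \<le> q" "a = munn fim_s p q n"
    by (rule monogenic_fim_normal_form)
  obtain p' q' n' where b: "- p' \<le> n'" "n' \<le> q'" "0 \<le> p'" "0 \<le> q'" "b = munn fim_s p' q' n'"
    by (rule monogenic_fim_normal_form)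
  have "n = n'" using assms(2) by (simp add: a b fim_pos_munn)
  moreover have "{1 - q..p} = {1 - q'..p'}"
    using assms(1) a b by (simp add: fim_edges_munn)
  \<comment> \<open>Empty intervals also determine the parameters: \<open>p < 1 - q\<close> with
    \<open>p\<close> and \<open>q\<close> nonnegative forces both to be 0.\<close>
  then have "p = p' \<and> q = q'" using a b by (auto simp: Icc_eq_Icc)
  ultimately show ?thesis by (simp add: a b)
qed


section \<open>Partial translations in the lamplighter group algebra\<close>

text \<open>The product of the \<open>a_i\<close> with \<open>i\<close> in \<open>J\<close>, written
  additively; for finite \<open>J\<close> this is the indicator function of
  \<open>J\<close>.\<close>

definition lamp_set :: "int set \<Rightarrow> (int \<Rightarrow>\<^sub>0 bit)" where
  "lamp_set J = (\<Sum>i\<in>J. Poly_Mapping.single i 1)"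

lemma lookup_lamp_set: "finite J \<Longrightarrow> Poly_Mapping.lookup (lamp_set J) i = of_bool (i \<in> J)"
  by (simp add: lamp_set_def lookup_sum lookup_single when_def)

lemma lamp_set_inject: "finite I \<Longrightarrow> finite J \<Longrightarrow> lamp_set I = lamp_set J \<longleftrightarrow> I = J"
  by (metis lookup_lamp_set of_bool_eq_iff set_eqI)

lemma uminus_lamps [simp]: "- f = (f :: int \<Rightarrow>\<^sub>0 bit)"
  by (rule poly_mapping_eqI) (simp add: lookup_uminus)

lemma shift_lamp_set: "finite J \<Longrightarrow> shift m (lamp_set J) = lamp_set ((\<lambda>i. i - m) ` J)"
  by (rule poly_mapping_eqI) (force simp: lookup_lamp_set)

text \<open>\<open>lamp_unit A n\<close> is \<open>(\<Prod>i\<in>A. e\<^sub>i) t\<^sup>n\<close> for finite \<open>A\<close>.\<close>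

definition lamp_unit :: "int set \<Rightarrow> int \<Rightarrow> (lamplighter \<Rightarrow>\<^sub>0 complex)" where
  "lamp_unit A n =
     (\<Sum>J\<in>Pow A. Poly_Mapping.single (Lamplighter (lamp_set J) n) (1 / 2 ^ card A))"

text \<open>Distinct finite sets give distinct group elements, so at most the summand
  \<open>I = J\<close> contributes.\<close>

lemma lookup_lamp_unit:
  assumes "finite A" "finite J"
  shows "Poly_Mapping.lookup (lamp_unit A n) (Lamplighter (lamp_set J) m)
    = (if m = n \<and> J \<subseteq> A then 1 / 2 ^ card A else 0)"
proof -
  have "(\<Sum>I\<in>Pow A. Poly_Mapping.lookup
        (Poly_Mapping.single (Lamplighter (lamp_set I) n) (1 / 2 ^ card A :: complex))
        (Lamplighter (lamp_set J) m))
      = (\<Sum>I\<in>Pow A. if I = J then if m = n then 1 / 2 ^ card A else 0 else 0)"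
    using assms
    by (intro sum.cong refl)
      (auto simp: lookup_single when_def lamp_set_inject dest: finite_subset)
  then show ?thesis using assms by (simp add: lamp_unit_def lookup_sum)
qed

lemma lamp_unit_in_monoid_algebra:
  assumes K: "conj_closed_subfield K"
  shows "lamp_unit A n \<in> monoid_algebra K"
proof -
  have "of_nat m \<in> K" for m :: nat
    by (induction m) (use K in \<open>auto simp: conj_closed_subfield_def\<close>)
  from this[of "2 ^ card A"] have "1 / 2 ^ card A \<in> K"
    using K by (auto simp: conj_closed_subfield_def divide_inverse)
  then have "Poly_Mapping.lookup (lamp_unit A n) x \<in> K" for x
    unfolding lamp_unit_def lookup_sum
    by (intro subfield_sum_closed[OF K])
      (use K in \<open>auto simp: lookup_single when_def conj_closed_subfield_def\<close>)
  then show ?thesis by (simp add: monoid_algebra_def)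
qed

lemma lamp_unit_empty: "lamp_unit {} n = Poly_Mapping.single (Lamplighter 0 n) 1"
  by (simp add: lamp_unit_def lamp_set_def)

lemma lamp_idem_mult_self: "lamp_idem i * lamp_idem i = lamp_idem i"
proof -
  define u :: "lamplighter \<Rightarrow>\<^sub>0 complex" where "u = Poly_Mapping.single (lamp i) 1"
  have "u * u = 1" by (simp add: u_def mult_single lamp_involutive)
  then have "(1 + u) * (1 + u) = scale 2 (1 + u)"
    using scale_add_left[of 1 1 "1 + u"] by (simp add: algebra_simps)
  then show ?thesis
    by (simp add: lamp_idem_def scale_mult_left scale_mult_right scale_scale flip: u_def)
qed

text \<open>For new \<open>i\<close>, the summands 1 and \<open>a_i\<close> of \<open>e_i\<close>
  yield the subsets without and with \<open>i\<close>. For \<open>i\<close> in \<open>A\<close>, a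
  factor \<open>e_i\<close> is split off and idempotency applies.\<close>

lemma lamp_idem_mult_lamp_unit:
  assumes "finite A"
  shows "lamp_idem i * lamp_unit A n = lamp_unit (insert i A) n"
proof -
  have new: "lamp_idem i * lamp_unit B n = lamp_unit (insert i B) n"
    if B: "finite B" "i \<notin> B" for B
  proof -
    let ?s = "\<lambda>J. Poly_Mapping.single (Lamplighter (lamp_set J) n)
      (1 / 2 ^ card (insert i B) :: complex)"
    have lamp: "lamp i + Lamplighter (lamp_set J) n = Lamplighter (lamp_set (insert i J)) n"
      if "J \<in> Pow B" for J
    proof -
      have "finite J" "i \<notin> J" using that B by (auto dest: finite_subset)
      then show ?thesis by (simp add: lamp_def plus_lamplighter_def lamp_set_def)
    qed
    have "lamp_unit (insert i B) n = sum ?s (Pow B) + sum ?s (insert i ` Pow B)"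
      unfolding lamp_unit_def Pow_insert
      by (rule sum.union_disjoint) (use B in auto)
    also have "sum ?s (insert i ` Pow B) = (\<Sum>J\<in>Pow B. ?s (insert i J))"
      by (rule sum.reindex_cong[of "insert i"]) (use B in \<open>auto simp: inj_on_def\<close>)
    finally show ?thesis
      using B lamp
      by (simp add: lamp_idem_def lamp_unit_def scale_mult_left distrib_right scale_add
          scale_sum sum_distrib_left mult_single sum.distrib)
  qed
  show ?thesis
  proof (cases "i \<in> A")
    case True
    then have "lamp_unit A n = lamp_idem i * lamp_unit (A - {i}) n"
      using new[of "A - {i}"] assms by (simp add: insert_absorb)
    then show ?thesis using True
      by (simp add: insert_absorb lamp_idem_mult_self flip: mult.assoc)
  qed (use assms new in simp)
qed

lemma lamp_unit_mult_pos_0: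
  assumes "finite A" "finite B"
  shows "lamp_unit A 0 * lamp_unit B n = lamp_unit (A \<union> B) n"
  using assms
proof (induction A rule: finite_induct)
  case empty
  then show ?case by (simp add: lamp_unit_empty flip: zero_lamplighter_def)
next
  case (insert i A)
  then show ?case by (simp add: mult.assoc flip: lamp_idem_mult_lamp_unit)
qed

lemma sum_Pow_image:
  assumes "inj f"
  shows "(\<Sum>J\<in>Pow (f ` A). F J) = (\<Sum>J\<in>Pow A. F (f ` J))"
  by (rule sum.reindex_bij_betw[symmetric])
    (use assms in \<open>auto intro!: bij_betw_Pow inj_on_imp_bij_betw inj_on_subset[OF assms]\<close>)

text \<open>Moving \<open>t^m\<close> to the right past \<open>a_i\<close> turns it into
  \<open>a_(i-m)\<close>; subsets of \<open>A\<close> are reindexed along this bijection.\<close>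

lemma translation_mult_lamp_unit:
  assumes "finite A"
  shows "Poly_Mapping.single (Lamplighter 0 m) 1 * lamp_unit A n
    = lamp_unit ((\<lambda>i. i - m) ` A) (m + n)"
proof -
  have "inj (\<lambda>i. i - m)" by (rule injI) simp
  moreover have "Lamplighter 0 m + Lamplighter (lamp_set J) n
      = Lamplighter (lamp_set ((\<lambda>i. i - m) ` J)) (m + n)" if "J \<subseteq> A" for J
    using that assms by (auto simp: plus_lamplighter_def shift_lamp_set dest: finite_subset)
  ultimately show ?thesis
    by (simp add: lamp_unit_def sum_distrib_left mult_single sum_Pow_image card_image inj_on_def)
qed

lemma lamp_unit_mult_translation:
  "lamp_unit A n = lamp_unit A 0 * Poly_Mapping.single (Lamplighter 0 n) 1"
  by (simp add: lamp_unit_def sum_distrib_right mult_single plus_lamplighter_def)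

lemma lamp_unit_mult:
  assumes "finite A" "finite B"
  shows "lamp_unit A m * lamp_unit B n = lamp_unit (A \<union> (\<lambda>i. i - m) ` B) (m + n)"
  by (subst lamp_unit_mult_translation)
    (simp add: assms mult.assoc translation_mult_lamp_unit lamp_unit_mult_pos_0)

text \<open>The adjoint is \<open>t^(-n)\<close> times the same product of self-adjoint
  \<open>e_i\<close>; moving \<open>t^(-n)\<close> to the right shifts the indices by
  \<open>n\<close>.\<close>

lemma alg_star_lamp_unit:
  assumes "finite A"
  shows "alg_star uminus (lamp_unit A n) = lamp_unit ((\<lambda>i. i + n) ` A) (- n)"
proof -
  have "inj (\<lambda>i. i + n)" by (rule injI) simp
  moreover have "- Lamplighter (lamp_set J) n = Lamplighter (lamp_set ((\<lambda>i. i + n) ` J)) (- n)"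
    if "J \<subseteq> A" for J
    using that assms by (auto simp: uminus_lamplighter_def shift_lamp_set dest: finite_subset)
  ultimately show ?thesis
    by (simp add: lamp_unit_def alg_star_sum sum_Pow_image card_image inj_on_def)
qed

section \<open>The representation and its linear independence\<close>

definition fim_rep :: "monogenic_fim \<Rightarrow> (lamplighter \<Rightarrow>\<^sub>0 complex)" where
  "fim_rep a = lamp_unit (fim_edges a) (fim_pos a)"

lemma fim_rep_independent:
  assumes "lin_ext fim_rep f = 0"
  shows "f = 0"
proof (rule ccontr)
  assume "f \<noteq> 0"
  let ?c = "\<lambda>a. card (fim_edges a)"
  have fin: "finite (?c ` Poly_Mapping.keys f)" by simp
  moreover have "?c ` Poly_Mapping.keys f \<noteq> {}" using \<open>f \<noteq> 0\<close> by simp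
  ultimately have "Max (?c ` Poly_Mapping.keys f) \<in> ?c ` Poly_Mapping.keys f" by (rule Max_in)
  then obtain a where a: "a \<in> Poly_Mapping.keys f"
    and "Max (?c ` Poly_Mapping.keys f) = ?c a"
    by (rule imageE)
  then have max: "?c b \<le> ?c a" if "b \<in> Poly_Mapping.keys f" for b
    using Max_ge[OF fin, OF imageI[OF that]] by simp
  let ?x = "Lamplighter (lamp_set (fim_edges a)) (fim_pos a)"
  have rep: "Poly_Mapping.lookup (fim_rep b) ?x = (if b = a then 1 / 2 ^ ?c a else 0)"
    if "b \<in> Poly_Mapping.keys f" for b
  proof -
    \<comment> \<open>The inclusion together with the maximal cardinality of
      \<open>fim_edges a\<close> forces equal edge sets, and edges and endpoint determine the
      element.\<close>
    have "b = a" if "fim_pos a = fim_pos b" "fim_edges a \<subseteq> fim_edges b"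
    proof (rule monogenic_fim_eqI)
      show "fim_edges b = fim_edges a"
        using card_seteq[OF finite_fim_edges that(2) max[OF \<open>b \<in> _\<close>]] by simp
    qed (use that in simp)
    then show ?thesis by (auto simp: fim_rep_def lookup_lamp_unit)
  qed
  have "0 = Poly_Mapping.lookup (lin_ext fim_rep f) ?x" by (simp add: assms)
  also have "\<dots> = (\<Sum>b\<in>Poly_Mapping.keys f.
      if b = a then Poly_Mapping.lookup f a / 2 ^ ?c a else 0)"
    unfolding lookup_lin_ext by (rule sum.cong) (simp_all add: rep)
  also have "\<dots> = Poly_Mapping.lookup f a / 2 ^ ?c a" using a by simp
  finally show False using a by (simp add: in_keys_iff)
qed

theorem proposition6p5:
  fixes K :: "complex set"
  assumes "conj_closed_subfield K"
  shows "\<exists>\<Phi> :: (monogenic_fim \<Rightarrow>\<^sub>0 complex) \<Rightarrow> (lamplighter \<Rightarrow>\<^sub>0 complex).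
           star_algebra_embedding K inv_star uminus \<Phi> \<and>
           \<Phi> (Poly_Mapping.single fim_s 1) = lamp_idem 0 * Poly_Mapping.single lt 1"
proof (intro exI conjI)
  have "fim_rep 0 = 1"
    by (simp add: fim_rep_def lamp_unit_empty flip: zero_lamplighter_def)
  \<comment> \<open>Edges and endpoints compose and invert by the same formulas as the index sets
    and exponents in \<open>lamp_unit_mult\<close> and \<open>alg_star_lamp_unit\<close>.\<close>
  moreover have "fim_rep (a + b) = fim_rep a * fim_rep b"
    "fim_rep (inv_star a) = alg_star uminus (fim_rep a)" for a b
    by (simp_all add: fim_rep_def lamp_unit_mult alg_star_lamp_unit)
  ultimately show "star_algebra_embedding K inv_star uminus (lin_ext fim_rep)"
    using assms fim_rep_independent lamp_unit_in_monoid_algebra[OF assms]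
    by (intro star_algebra_embedding_lin_ext) (simp_all add: fim_rep_def)
  show "lin_ext fim_rep (Poly_Mapping.single fim_s 1) = lamp_idem 0 * Poly_Mapping.single lt 1"
    using lamp_idem_mult_lamp_unit[of "{}" 0 1]
    by (simp add: fim_rep_def lamp_unit_empty lt_def)
qed

end
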